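(* There is a pair of polygons $P_-$ and $P_+$ for which every symplectic billiard orbit (on the phase space $\mathcal{P}$) is periodic, but the periods of these orbits are not uniformly bounded.
   Context: Polygons. Let $v_1,\dots,v_n\in\mathbb{R}^2$ be pairwise distinct (indices read cyclically) such that any two distinct open segments $v_iv_{i+1}$, $v_jv_{j+1}$ do not intersect, no open segment $v_jv_{j+1}$ contains any $v_i$, and no three consecutive $v_i,v_{i+1},v_{i+2}$ are collinear. The union $P$ of the closed segments $\overline{v_iv_{i+1}}$ is a polygon (not necessarily convex) with vertex set $V=\{v_1,\dots,v_n\}$ and (open) edges $v_iv_{i+1}$. $\mathrm{int}(P)$ is the bounded component of $\mathbb{R}^2\setminus P$. For points $a,b$, $ab$ denotes the open segment between them. For $x\in P\setminus V$, $T_xP\subset\mathbb{R}^2$ is the linear line parallel to the edge containing $x$. Pairs. $(P_-,P_+)$ is a pair of polygons with vertex sets $V_-,V_+$. The notation $P_\pm,P_\mp$ indicates a choice of sign and its opposite. A pair $(x,y)\in P_\pm\times P_\mp$ satisfies condition A if $y\notin V_\mp$ and there is exactly one $z\in P_\pm\cap\{x+t: t\in T_yP_\mp, t\neq 0\}$ with $xz\subset\mathrm{int}(P_\pm)$. Let $\mathcal{P}_{\max}$ be the set of $(x,y)\in(P_-\times P_+)\sqcup(P_+\times P_-)$ satisfying condition A. The symplectic billiard map is $\phi:\mathcal{P}_{\max}\to(P_-\times P_+)\sqcup(P_+\times P_-)$, $\phi(x,y)=(y,z)$ with this $z$. Phase space. Let $\sigma(x,y)=(y,x)$, $N_0=(P_-\times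 V_+)\sqcup(P_+\times V_-)$, $N_{i+1}=\phi^{-1}(N_i)$ (preimage) for $i\ge 0$, and $N=\bigcup_{i\ge0}N_i\cup\sigma(\bigcup_{i\ge0}N_i)$. The phase space is $\mathcal{P}=\mathcal{P}_{\max}\setminus N$; $\phi$ restricts to a bijection of $\mathcal{P}$. The orbit of $(x_0,x_1)\in\mathcal{P}$ is $(\phi^k(x_0,x_1))_{k\in\mathbb{Z}}$; it is periodic if $\phi^n(x_0,x_1)=(x_0,x_1)$ for some $n\ge1$, and the least such $n$ is its period. *)

theory Defs
  imports "HOL-Analysis.Analysis"
begin

section \<open>Polygons\<close>

text \<open>A polygon is given by the cyclically read list of its vertices
  (the list is indexed from 0).\<close>

type_synonym vertices = "(real^2) list"

definition vertex :: "vertices \<Rightarrow> nat \<Rightarrow> real^2" where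
  "vertex vs i = vs ! (i mod length vs)"

definition open_edge :: "vertices \<Rightarrow> nat \<Rightarrow> (real^2) set" where
  "open_edge vs i = open_segment (vertex vs i) (vertex vs (Suc i))"

definition curve :: "vertices \<Rightarrow> (real^2) set" where
  "curve vs = (\<Union>i<length vs. closed_segment (vertex vs i) (vertex vs (Suc i)))"

text \<open>The bound \<open>3 \<le> length vs\<close> only excludes the empty list: for one or two vertices
  the non-collinearity condition already fails.\<close>

definition polygon :: "vertices \<Rightarrow> bool" where
  "polygon vs \<longleftrightarrow>
     3 \<le> length vs \<and> distinct vs \<and>
     (\<forall>i<length vs. \<forall>j<length vs. i \<noteq> j \<longrightarrow> open_edge vs i \<inter> open_edge vs j = {}) \<and>
     (\<forall>j<length vs. open_edge vs j \<inter> set vs = {}) \<and>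
     (\<forall>i<length vs. \<not> collinear {vertex vs i, vertex vs (Suc i), vertex vs (Suc (Suc i))})"

text \<open>The library's \<^const>\<open>inside\<close> is the union of the bounded components of the complement.
  As the curve of a polygon is a simple closed curve, there is exactly one of these.\<close>

definition interior_region :: "vertices \<Rightarrow> (real^2) set" where
  "interior_region vs = inside (curve vs)"

text \<open>A point of the curve other than a vertex lies on exactly one open edge; at all other points
  the following set is empty.\<close>

definition tangent_line :: "vertices \<Rightarrow> real^2 \<Rightarrow> (real^2) set" where
  "tangent_line vs x =
     (\<Union>i\<in>{i. i < length vs \<and> x \<in> open_edge vs i}. span {vertex vs (Suc i) - vertex vs i})"


section \<open>The symplectic billiard map\<close>

text \<open>A pair of polygons is a family \<open>Q\<close> indexed by a sign. The disjoint union
  $(P_- \times P_+) \sqcup (P_+ \times P_-)$ is rendered by triples \<open>(s, x, y)\<close>, where \<open>x\<close> lies on the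
  polygon with sign \<open>s\<close> and \<open>y\<close> on the one with the opposite sign; the tag is needed since the two
  polygons may intersect or even coincide.\<close>

datatype polarity = Minus | Plus

fun opp :: "polarity \<Rightarrow> polarity" where
  "opp Minus = Plus"
| "opp Plus = Minus"

type_synonym polygon_pair = "polarity \<Rightarrow> vertices"
type_synonym state = "polarity \<times> (real^2) \<times> (real^2)"

definition target :: "polygon_pair \<Rightarrow> polarity \<Rightarrow> real^2 \<Rightarrow> real^2 \<Rightarrow> real^2 \<Rightarrow> bool" where
  "target Q s x y z \<longleftrightarrow>
     z \<in> curve (Q s) \<inter> {x + t | t. t \<in> tangent_line (Q (opp s)) y \<and> t \<noteq> 0} \<and>
     open_segment x z \<subseteq> interior_region (Q s)"

definition condition_A :: "polygon_pair \<Rightarrow> polarity \<Rightarrow> real^2 \<Rightarrow> real^2 \<Rightarrow> bool" where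
  "condition_A Q s x y \<longleftrightarrow> y \<notin> set (Q (opp s)) \<and> (\<exists>!z. target Q s x y z)"

definition P_max :: "polygon_pair \<Rightarrow> state set" where
  "P_max Q = {(s, x, y). x \<in> curve (Q s) \<and> y \<in> curve (Q (opp s)) \<and> condition_A Q s x y}"

text \<open>The map is only meaningful on \<open>P_max Q\<close>; outside its values are arbitrary.\<close>

definition phi :: "polygon_pair \<Rightarrow> state \<Rightarrow> state" where
  "phi Q = (\<lambda>(s, x, y). (opp s, y, THE z. target Q s x y z))"

definition swap_state :: "state \<Rightarrow> state" where
  "swap_state = (\<lambda>(s, x, y). (opp s, y, x))"


section \<open>Phase space and periodic orbits\<close>

text \<open>Preimages are taken under the partial map, i.e. within its domain \<open>P_max Q\<close>.\<close>

primrec N_step :: "polygon_pair \<Rightarrow> nat \<Rightarrow> state set" where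
  "N_step Q 0 = {(s, x, y). x \<in> curve (Q s) \<and> y \<in> set (Q (opp s))}"
| "N_step Q (Suc i) = {p \<in> P_max Q. phi Q p \<in> N_step Q i}"

definition N_set :: "polygon_pair \<Rightarrow> state set" where
  "N_set Q = (\<Union>i. N_step Q i) \<union> swap_state ` (\<Union>i. N_step Q i)"

definition phase_space :: "polygon_pair \<Rightarrow> state set" where
  "phase_space Q = P_max Q - N_set Q"

text \<open>The phase space is invariant under \<open>phi Q\<close>, so for \<open>p\<close> in the phase space these iterates
  never leave the domain of the map.\<close>

definition periodic :: "polygon_pair \<Rightarrow> state \<Rightarrow> bool" where
  "periodic Q p \<longleftrightarrow> (\<exists>n\<ge>1. (phi Q ^^ n) p = p)"

definition period :: "polygon_pair \<Rightarrow> state \<Rightarrow> nat" where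
  "period Q p = (LEAST n. 1 \<le> n \<and> (phi Q ^^ n) p = p)"

end

(* Both triangles are isosceles with base from (-1, 0) to (1, 0); their apexes have heights 1 and 3.
   Every orbit visits states with x on the base of the first triangle, at abscissa e * a, and y on
   the side of the second triangle with sign -e, at distance |y1| = v from the axis. On these
   (a, v) the return map does not change e and is
     (a, v) -> (1 + 2a, v/2)      if a < -1/3             (the distance from the corner -1 doubles),
     (a, v) -> ((1 + a)/2, 2v)    if a > -1/3, v < 1/2    (the distance from the corner 1 halves),
     (a, v) -> (-a, 3/2 - v)      if a > -1/3, v > 1/2.
   If |a| < 1/3 and 1/2 < 2^n v < 1, then n steps of the second kind, one of the third and n of the
   first kind yield (-a, 3/2^(n+1) - v), a point reflection of this rectangle. So it consists of
   periodic points; their period is unbounded in n as v keeps doubling for n steps. All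
   other orbits not running into a vertex enter one of these rectangles. *)
theory Submission imports Defs begin

section \<open>Isosceles triangles\<close>

abbreviation pt :: "real \<Rightarrow> real \<Rightarrow> real^2" where
  "pt a b \<equiv> vector [a, b]"

definition tri :: "real \<Rightarrow> vertices" where
  "tri h = [pt (-1) 0, pt 1 0, pt 0 h]"

lemma vec2_eq_iff: "(p :: real^2) = q \<longleftrightarrow> p $ 1 = q $ 1 \<and> p $ 2 = q $ 2"
  by (simp add: vec_eq_iff forall_2)

lemma vertex_tri [simp]:
  "vertex (tri h) 0 = pt (-1) 0"
  "vertex (tri h) (Suc 0) = pt 1 0"
  "vertex (tri h) (Suc (Suc 0)) = pt 0 h"
  "vertex (tri h) (Suc (Suc (Suc 0))) = pt (-1) 0"
  "vertex (tri h) (Suc (Suc (Suc (Suc 0)))) = pt 1 0"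
  by (simp_all add: vertex_def tri_def)

lemma length_tri [simp]: "length (tri h) = Suc (Suc (Suc 0))"
  by (simp add: tri_def)

lemma all_less_3: "(\<forall>i<Suc (Suc (Suc 0)). P i) \<longleftrightarrow> P 0 \<and> P (Suc 0) \<and> P (Suc (Suc 0))"
  by (auto simp: less_Suc_eq)

lemma open_edge_tri:
  "open_edge (tri h) 0 = {p. p $ 2 = 0 \<and> \<bar>p $ 1\<bar> < 1}"
  "open_edge (tri h) (Suc 0) = {p. 0 < p $ 1 \<and> p $ 1 < 1 \<and> p $ 2 = h * (1 - p $ 1)}"
  "open_edge (tri h) (Suc (Suc 0)) = {p. -1 < p $ 1 \<and> p $ 1 < 0 \<and> p $ 2 = h * (1 + p $ 1)}"
proof -
  show "open_edge (tri h) 0 = {p. p $ 2 = 0 \<and> \<bar>p $ 1\<bar> < 1}"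
  proof (intro set_eqI iffI)
    fix p :: "real^2" assume "p \<in> {p. p $ 2 = 0 \<and> \<bar>p $ 1\<bar> < 1}"
    then show "p \<in> open_edge (tri h) 0"
      by (auto simp: open_edge_def in_segment vec2_eq_iff abs_less_iff field_simps intro!: exI[of _ "(1 + p $ 1) / 2"])
  qed (auto simp: open_edge_def in_segment vec2_eq_iff abs_less_iff)
  show "open_edge (tri h) (Suc 0) = {p. 0 < p $ 1 \<and> p $ 1 < 1 \<and> p $ 2 = h * (1 - p $ 1)}"
  proof (intro set_eqI iffI)
    fix p :: "real^2" assume "p \<in> {p. 0 < p $ 1 \<and> p $ 1 < 1 \<and> p $ 2 = h * (1 - p $ 1)}"
    then show "p \<in> open_edge (tri h) (Suc 0)"
      by (auto simp: open_edge_def in_segment vec2_eq_iff intro!: exI[of _ "1 - p $ 1"])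
  next
    fix p assume "p \<in> open_edge (tri h) (Suc 0)"
    then obtain u where "0 < u" "u < 1" "p $ 1 = 1 - u" "p $ 2 = u * h"
      by (auto simp: open_edge_def in_segment vec2_eq_iff)
    then show "p \<in> {p. 0 < p $ 1 \<and> p $ 1 < 1 \<and> p $ 2 = h * (1 - p $ 1)}" by simp
  qed
  show "open_edge (tri h) (Suc (Suc 0)) = {p. -1 < p $ 1 \<and> p $ 1 < 0 \<and> p $ 2 = h * (1 + p $ 1)}"
  proof (intro set_eqI iffI)
    fix p :: "real^2" assume "p \<in> {p. -1 < p $ 1 \<and> p $ 1 < 0 \<and> p $ 2 = h * (1 + p $ 1)}"
    then show "p \<in> open_edge (tri h) (Suc (Suc 0))"
      by (auto simp: open_edge_def in_segment vec2_eq_iff intro!: exI[of _ "- p $ 1"])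
  next
    fix p assume "p \<in> open_edge (tri h) (Suc (Suc 0))"
    then obtain u where "0 < u" "u < 1" "p $ 1 = - u" "p $ 2 = (1 - u) * h"
      by (auto simp: open_edge_def in_segment vec2_eq_iff)
    then show "p \<in> {p. -1 < p $ 1 \<and> p $ 1 < 0 \<and> p $ 2 = h * (1 + p $ 1)}" by simp
  qed
qed

lemma set_tri: "set (tri h) = {pt (-1) 0, pt 1 0, pt 0 h}"
  by (simp add: tri_def)

lemma polygon_tri:
  assumes "h > 0"
  shows "polygon (tri h)"
proof -
  have "distinct (tri h)"
    using assms by (auto simp: tri_def vec2_eq_iff)
  moreover have nc: "\<not> collinear {pt (-1) 0, pt 1 0, pt 0 h}"
  proof -
    have "\<not> collinear {0, pt (-1) 0 - pt 1 0, pt 0 h - pt 1 0}"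
      unfolding collinear_lemma using assms by (auto simp: vec2_eq_iff)
    then show ?thesis
      \<comment> \<open>The middle vertex is translated to the origin; unfolding
        \<open>NO_MATCH\<close> discharges the guard that \<open>collinear_3\<close>
        carries.\<close>
      by (subst collinear_3) (simp_all add: NO_MATCH_def)
  qed
  moreover have "\<not> collinear {pt 1 0, pt 0 h, pt (-1) 0}" "\<not> collinear {pt 0 h, pt (-1) 0, pt 1 0}"
    using nc by (metis insert_commute)+
  moreover have "\<forall>j<length (tri h). open_edge (tri h) j \<inter> set (tri h) = {}"
    unfolding length_tri all_less_3 open_edge_tri set_tri using assms by auto
  moreover have "\<forall>i<length (tri h). \<forall>j<length (tri h). i \<noteq> j \<longrightarrow> open_edge (tri h) i \<inter> open_edge (tri h) j = {}"
    unfolding length_tri all_less_3 open_edge_tri using assms by auto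
  ultimately show ?thesis
    unfolding polygon_def by (simp add: all_less_3)
qed

lemma hull_tri:
  assumes "h > 0"
  shows "convex hull {pt (-1) 0, pt 1 0, pt 0 h} = {p. 0 \<le> p $ 2 \<and> p $ 2 \<le> h * (1 - \<bar>p $ 1\<bar>)}"
proof (intro set_eqI iffI)
  fix p :: "real^2" assume p: "p \<in> {p. 0 \<le> p $ 2 \<and> p $ 2 \<le> h * (1 - \<bar>p $ 1\<bar>)}"
  \<comment> \<open>\<open>w\<close> is the barycentric weight of the apex. The remaining
    \<open>1 - w\<close> is divided between the two base corners so that their weights differ by
    \<open>p $ 1\<close>.\<close>
  define w where "w = p $ 2 / h"
  have w: "p $ 2 = h * w" using assms by (simp add: w_def)
  have wb: "0 \<le> w" "w \<le> 1 - \<bar>p $ 1\<bar>" using assms p by (simp_all add: w_def field_simps)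
  show "p \<in> convex hull {pt (-1) 0, pt 1 0, pt 0 h}"
    unfolding convex_hull_3 mem_Collect_eq
    by (rule exI[of _ "(1 - w - p $ 1) / 2"], rule exI[of _ "(1 - w + p $ 1) / 2"], rule exI[of _ w])
      (use wb in \<open>auto simp: vec2_eq_iff w field_simps\<close>)
next
  fix p :: "real^2" assume "p \<in> convex hull {pt (-1) 0, pt 1 0, pt 0 h}"
  then obtain u v w where uvw: "0 \<le> u" "0 \<le> v" "0 \<le> w" "u + v + w = 1"
    and p: "p $ 1 = v - u" "p $ 2 = w * h"
    by (auto simp: convex_hull_3 vec2_eq_iff)
  have "w \<le> 1 - \<bar>p $ 1\<bar>" using uvw p by (auto simp: abs_if)
  then show "p \<in> {p. 0 \<le> p $ 2 \<and> p $ 2 \<le> h * (1 - \<bar>p $ 1\<bar>)}"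
    using uvw assms p by (auto simp: mult.commute[of h])
qed

lemma curve_tri_segments:
  "curve (tri h) = closed_segment (pt (-1) 0) (pt 1 0) \<union> closed_segment (pt 1 0) (pt 0 h)
     \<union> closed_segment (pt 0 h) (pt (-1) 0)"
  by (auto simp: curve_def less_Suc_eq)

lemma frontier_hull_tri: "frontier (convex hull {pt (-1) 0, pt 1 0, pt 0 h}) = curve (tri h)"
  by (simp add: frontier_of_triangle curve_tri_segments)

lemma interior_region_tri:
  "interior_region (tri h) = interior (convex hull {pt (-1) 0, pt 1 0, pt 0 h})"
  by (simp add: interior_region_def curve_tri_segments inside_of_triangle)

lemma curve_tri:
  assumes "h > 0"
  shows "curve (tri h) = {p. p $ 2 = 0 \<and> \<bar>p $ 1\<bar> \<le> 1} \<union> {p. \<bar>p $ 1\<bar> \<le> 1 \<and> p $ 2 = h * (1 - \<bar>p $ 1\<bar>)}"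
proof -
  have ceq: "curve (tri h) = open_edge (tri h) 0 \<union> open_edge (tri h) (Suc 0)
      \<union> open_edge (tri h) (Suc (Suc 0)) \<union> {pt (-1) 0, pt 1 0, pt 0 h}"
    by (auto simp: curve_tri_segments open_edge_def closed_segment_eq_open)
  have eq: "p \<in> curve (tri h) \<longleftrightarrow> p $ 2 = 0 \<and> \<bar>p $ 1\<bar> < 1 \<or> 0 < p $ 1 \<and> p $ 1 < 1 \<and> p $ 2 = h * (1 - p $ 1)
      \<or> -1 < p $ 1 \<and> p $ 1 < 0 \<and> p $ 2 = h * (1 + p $ 1) \<or> p $ 1 = -1 \<and> p $ 2 = 0 \<or> p $ 1 = 1 \<and> p $ 2 = 0
      \<or> p $ 1 = 0 \<and> p $ 2 = h" for p
    unfolding ceq open_edge_tri by (auto simp: vec2_eq_iff)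
  show ?thesis
  proof (rule set_eqI)
    fix p :: "real^2"
    consider "p $ 1 = 1" | "p $ 1 = -1" | "0 < p $ 1" "p $ 1 < 1" | "-1 < p $ 1" "p $ 1 < 0" | "p $ 1 = 0" | "\<bar>p $ 1\<bar> > 1"
      by linarith
    then show "p \<in> curve (tri h) \<longleftrightarrow> p \<in> {p. p $ 2 = 0 \<and> \<bar>p $ 1\<bar> \<le> 1} \<union> {p. \<bar>p $ 1\<bar> \<le> 1 \<and> p $ 2 = h * (1 - \<bar>p $ 1\<bar>)}"
      unfolding eq by cases auto
  qed
qed

text \<open>The inside of the curve is the hull without its boundary, so the descriptions of hull
  and curve can be subtracted from each other.\<close>

lemma interior_region_tri_eq:
  assumes "h > 0"
  shows "interior_region (tri h) = {p. 0 < p $ 2 \<and> p $ 2 < h * (1 - \<bar>p $ 1\<bar>)}"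
proof (rule set_eqI)
  fix p :: "real^2"
  have "interior_region (tri h) = convex hull {pt (-1) 0, pt 1 0, pt 0 h} - curve (tri h)"
    by (simp add: interior_region_tri interior_of_triangle curve_tri_segments)
  then have "p \<in> interior_region (tri h) \<longleftrightarrow> 0 \<le> p $ 2 \<and> p $ 2 \<le> h * (1 - \<bar>p $ 1\<bar>) \<and> p \<notin> curve (tri h)"
    by (simp add: hull_tri[OF assms])
  moreover have "\<bar>p $ 1\<bar> \<le> 1" if "0 \<le> h * (1 - \<bar>p $ 1\<bar>)"
    using that assms by (simp add: zero_le_mult_iff)
  ultimately show "p \<in> interior_region (tri h) \<longleftrightarrow> p \<in> {p. 0 < p $ 2 \<and> p $ 2 < h * (1 - \<bar>p $ 1\<bar>)}"
    by (simp add: curve_tri[OF assms]) linarith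
qed

section \<open>Chords\<close>

lemma in_open_segment_iff:
  fixes x z :: "'a :: euclidean_space"
  shows "w \<in> open_segment x z \<longleftrightarrow> x \<noteq> z \<and> (\<exists>u. 0 < u \<and> u < 1 \<and> w = x + u *\<^sub>R (z - x))"
  by (simp add: in_segment algebra_simps)

text \<open>If two targets lay on the same side of \<open>x\<close>, the nearer one would be a
  boundary point on an open chord that lies in the interior. If they lay on opposite sides,
  \<open>x\<close> would be between an interior point of \<open>K\<close> and a point of its
  closure, and hence interior by convexity.\<close>

lemma target_unique:
  assumes K: "convex K" and cur: "curve (Q s) = frontier K" "interior_region (Q s) = interior K"
    and tan: "tangent_line (Q (opp s)) y = span {d}"
    and x: "x \<in> curve (Q s)" and z: "target Q s x y z" and z': "target Q s x y z'"
  shows "z = z'"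
proof (rule ccontr)
  assume "z \<noteq> z'"
  obtain \<alpha> where \<alpha>: "z = x + \<alpha> *\<^sub>R d" "\<alpha> \<noteq> 0"
    using z by (auto simp: target_def tan span_singleton)
  obtain \<beta> where \<beta>: "z' = x + \<beta> *\<^sub>R d" "\<beta> \<noteq> 0"
    using z' by (auto simp: target_def tan span_singleton)
  have dis: "w \<notin> interior K" if "w \<in> curve (Q s)" for w
    using that cur by (simp add: frontier_def)
  have inK: "z' \<in> closure K"
    using z' cur by (auto simp: target_def frontier_def)
  have seg: "open_segment x z \<subseteq> interior K" "open_segment x z' \<subseteq> interior K"
    using z z' cur by (auto simp: target_def)
  have ne: "x \<noteq> z" "x \<noteq> z'" using z z' by (auto simp: target_def)
  \<comment> \<open>On the common line \<open>x\<close> is taken as the origin and \<open>D\<close>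
    as the unit, so \<open>z'\<close> has coordinate \<open>1\<close> and \<open>z\<close> has
    coordinate \<open>r\<close>.\<close>
  define r where "r = \<alpha> / \<beta>"
  define D where "D = z' - x"
  have r: "z = x + r *\<^sub>R D" "z' = x + D" "r \<noteq> 0" "r \<noteq> 1"
    using \<alpha> \<beta> \<open>z \<noteq> z'\<close> by (auto simp: r_def D_def)
  consider "0 < r" "r < 1" | "1 < r" | "r < 0" using r by linarith
  then show False
  proof cases
    case 1
    then have "z \<in> open_segment x z'"
      using r ne unfolding in_open_segment_iff by auto
    then show False using seg dis z by (auto simp: target_def)
  next
    case 2
    then have "z' \<in> open_segment x z"
      using r ne unfolding in_open_segment_iff by (auto intro!: exI[of _ "1 / r"])
    then show False using seg dis z' by (auto simp: target_def)
  next
    case 3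
    define m where "m = x + (r / 2) *\<^sub>R D"
    have "m \<in> open_segment x z"
      using r ne unfolding in_open_segment_iff m_def by (auto intro!: exI[of _ "1 / 2"])
    then have m: "m \<in> interior K" using seg by blast
    \<comment> \<open>\<open>m\<close> has coordinate \<open>r / 2 < 0\<close> and \<open>z'\<close>
      has \<open>1\<close>; \<open>u\<close> is the fraction of the way from \<open>m\<close> to
      \<open>z'\<close> at which the coordinate \<open>0\<close> of \<open>x\<close> is met.\<close>
    define u where "u = - (r / 2) / (1 - r / 2)"
    have u: "0 < u" "u < 1" "r / 2 + u * (1 - r / 2) = 0" using 3 by (auto simp: u_def field_simps)
    have "m + u *\<^sub>R (z' - m) = x + (r / 2 + u * (1 - r / 2)) *\<^sub>R D"
      unfolding m_def r(2) by (simp only: algebra_simps scaleR_scaleR mult_1_left)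
    then have "x = m + u *\<^sub>R (z' - m)" using u by simp
    moreover have "m \<noteq> z'" using m dis z' by (auto simp: target_def)
    ultimately have "x \<in> open_segment m z'"
      using u unfolding in_open_segment_iff by blast
    then have "x \<in> interior K"
      using in_interior_closure_convex_segment[OF K m inK] by blast
    then show False using dis x by blast
  qed
qed

section \<open>The pair of triangles, its edges and their directions\<close>

fun apex :: "polarity \<Rightarrow> real" where
  "apex Minus = 1"
| "apex Plus = 3"

definition triangle_pair :: polygon_pair where
  "triangle_pair s = tri (apex s)"

lemma apex_pos [simp]: "apex s > 0" and apex_nonzero [simp]: "apex s \<noteq> 0"
  by (cases s; simp)+

lemma apex_nonneg [simp]: "apex s \<ge> 0"
  by (simp add: less_imp_le)

lemma abs_eq_1E:
  assumes "\<bar>f :: real\<bar> = 1" obtains "f = 1" | "f = -1"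
  using assms by (auto simp: abs_if split: if_splits)

abbreviation base :: "real \<Rightarrow> real^2" where
  "base a \<equiv> pt a 0"

text \<open>The sign \<open>f\<close> selects the right or left side and \<open>u\<close> is the
  distance from the axis: \<open>u = 0\<close> gives the apex, \<open>u = 1\<close> a corner of the
  base.\<close>

definition side :: "real \<Rightarrow> real \<Rightarrow> real \<Rightarrow> real^2" where
  "side h f u = pt (f * u) (h * (1 - u))"

lemma side_nth [simp]: "side h f u $ 1 = f * u" "side h f u $ 2 = h * (1 - u)"
  by (simp_all add: side_def)

definition regular_point :: "polarity \<Rightarrow> real^2 \<Rightarrow> bool" where
  "regular_point s x \<longleftrightarrow> x \<in> curve (triangle_pair s) \<and> x \<notin> set (triangle_pair s)"

lemma regular_point_cases:
  assumes "regular_point s x"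
  obtains a where "\<bar>a\<bar> < 1" "x = base a"
  | f u where "\<bar>f\<bar> = 1" "0 < u" "u < 1" "x = side (apex s) f u"
proof -
  have x: "x $ 2 = 0 \<and> \<bar>x $ 1\<bar> \<le> 1 \<or> \<bar>x $ 1\<bar> \<le> 1 \<and> x $ 2 = apex s * (1 - \<bar>x $ 1\<bar>)"
    "x \<noteq> pt (-1) 0" "x \<noteq> pt 1 0" "x \<noteq> pt 0 (apex s)"
    using assms by (auto simp: regular_point_def triangle_pair_def curve_tri set_tri)
  show thesis
  proof (cases "x $ 2 = 0")
    case True
    then have "\<bar>x $ 1\<bar> < 1" using x by (auto simp: vec2_eq_iff abs_if split: if_splits)
    with True show thesis using that(1)[of "x $ 1"] by (simp add: vec2_eq_iff)
  next
    case False
    with x have "x $ 2 = apex s * (1 - \<bar>x $ 1\<bar>)" "\<bar>x $ 1\<bar> \<le> 1" by auto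
    moreover from this False have "\<bar>x $ 1\<bar> < 1" by (cases "\<bar>x $ 1\<bar> = 1") auto
    moreover have "x $ 1 \<noteq> 0" using x calculation by (auto simp: vec2_eq_iff)
    ultimately show thesis using that(2)[of "sgn (x $ 1)" "\<bar>x $ 1\<bar>"]
      by (auto simp: vec2_eq_iff abs_sgn_eq mult_sgn_abs)
  qed
qed

lemma regular_point_base [simp]: "\<bar>a\<bar> < 1 \<Longrightarrow> regular_point s (base a)"
  using apex_pos[of s] by (auto simp: regular_point_def triangle_pair_def curve_tri set_tri vec2_eq_iff)

lemma regular_point_side [simp]:
  "\<bar>f\<bar> = 1 \<Longrightarrow> 0 < u \<Longrightarrow> u < 1 \<Longrightarrow> regular_point s (side (apex s) f u)"
  by (auto simp: regular_point_def triangle_pair_def curve_tri set_tri vec2_eq_iff abs_mult)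

lemma span_singleton_scale:
  fixes d :: "'a :: real_vector"
  assumes "c \<noteq> 0"
  shows "span {c *\<^sub>R d} = span {d}"
proof (rule antisym; rule span_minimal)
  have "(1 / c) *\<^sub>R (c *\<^sub>R d) \<in> span {c *\<^sub>R d}" by (intro span_mul span_base) simp
  then show "{d} \<subseteq> span {c *\<^sub>R d}" using assms by simp
qed (auto intro: span_mul span_base)

lemma tangent_line_base:
  assumes "\<bar>a\<bar> < 1"
  shows "tangent_line (triangle_pair s) (base a) = span {pt 1 0}"
proof -
  have "{i. i < length (triangle_pair s) \<and> base a \<in> open_edge (triangle_pair s) i} = {0}"
    using assms apex_pos[of s] by (auto simp: triangle_pair_def less_Suc_eq open_edge_tri)
  then have "tangent_line (triangle_pair s) (base a) = span {vertex (tri (apex s)) (Suc 0) - vertex (tri (apex s)) 0}"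
    by (simp add: tangent_line_def triangle_pair_def)
  also have "\<dots> = span {pt 1 0}"
  proof -
    have "vertex (tri (apex s)) (Suc 0) - vertex (tri (apex s)) 0 = 2 *\<^sub>R pt 1 0"
      by (simp add: vec2_eq_iff)
    then show ?thesis by (simp add: span_singleton_scale)
  qed
  finally show ?thesis .
qed

lemma tangent_line_side:
  assumes "\<bar>f\<bar> = 1" "0 < u" "u < 1"
  shows "tangent_line (triangle_pair s) (side (apex s) f u) = span {pt f (- apex s)}"
proof -
  define i :: nat where "i = (if f = 1 then 1 else 2)"
  have "{i. i < length (triangle_pair s) \<and> side (apex s) f u \<in> open_edge (triangle_pair s) i} = {i}"
    using assms(1)
    by (rule abs_eq_1E; use assms in \<open>auto simp: i_def triangle_pair_def less_Suc_eq open_edge_tri numeral_2_eq_2\<close>)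
  then have "tangent_line (triangle_pair s) (side (apex s) f u) = span {vertex (tri (apex s)) (Suc i) - vertex (tri (apex s)) i}"
    by (simp add: tangent_line_def triangle_pair_def)
  \<comment> \<open>The vertex list runs up the right side and down the left one, whereas
    \<open>pt f (- apex s)\<close> points downwards on both; hence the sign.\<close>
  also have "vertex (tri (apex s)) (Suc i) - vertex (tri (apex s)) i = (if f = 1 then -1 else 1) *\<^sub>R pt f (- apex s)"
    using assms(1) by (rule abs_eq_1E) (simp_all add: i_def vec2_eq_iff numeral_2_eq_2)
  also have "span {\<dots>} = span {pt f (- apex s)}"
    by (rule span_singleton_scale) simp
  finally show ?thesis .
qed

lemma in_span_base: "t \<in> span {pt 1 0} \<longleftrightarrow> t $ 2 = 0"
  by (auto simp: span_singleton vec2_eq_iff)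

lemma in_span_side: "\<bar>f\<bar> = 1 \<Longrightarrow> t \<in> span {pt f (- h)} \<longleftrightarrow> t $ 2 = - h * f * t $ 1"
proof
  assume f: "\<bar>f\<bar> = 1" and t: "t $ 2 = - h * f * t $ 1"
  have "f * f = 1" using f by (rule abs_eq_1E) auto
  then have "t = (f * t $ 1) *\<^sub>R pt f (- h)"
    using t by (simp add: vec2_eq_iff)
  then show "t \<in> span {pt f (- h)}"
    by (metis insertI1 span_base span_mul)
qed (auto simp: span_singleton elim!: abs_eq_1E)

lemma triangle_pair_target_unique:
  assumes "regular_point (opp s) y" "x \<in> curve (triangle_pair s)" "target triangle_pair s x y z" "target triangle_pair s x y z'"
  shows "z = z'"
proof -
  obtain d where d: "tangent_line (triangle_pair (opp s)) y = span {d}"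
    using assms(1) by (cases rule: regular_point_cases) (auto simp: tangent_line_base tangent_line_side)
  show ?thesis
    by (rule target_unique[OF _ _ _ d assms(2-4)])
      (auto simp: triangle_pair_def frontier_hull_tri interior_region_tri)
qed

text \<open>A triangle is the intersection of three half-planes. A proper convex combination of two
  of its points is strictly inside a half-plane unless both points lie on the bounding line, and the
  last three assumptions exclude this for each line. The end \<open>z\<close> may be a vertex, which
  is used for the singular states.\<close>

lemma chord:
  assumes x: "x \<in> curve (triangle_pair s)" and z: "z \<in> curve (triangle_pair s)"
    and y: "regular_point (opp s) y" and t: "z - x \<in> tangent_line (triangle_pair (opp s)) y" "x \<noteq> z"
    and base: "x $ 2 \<noteq> 0 \<or> z $ 2 \<noteq> 0"
    and right: "apex s * x $ 1 + x $ 2 \<noteq> apex s \<or> apex s * z $ 1 + z $ 2 \<noteq> apex s"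
    and left: "- apex s * x $ 1 + x $ 2 \<noteq> apex s \<or> - apex s * z $ 1 + z $ 2 \<noteq> apex s"
  shows "(s, x, y) \<in> P_max triangle_pair \<and> phi triangle_pair (s, x, y) = (opp s, y, z)"
proof -
  have C: "0 \<le> p $ 2 \<and> apex s * p $ 1 + p $ 2 \<le> apex s \<and> - apex s * p $ 1 + p $ 2 \<le> apex s" if "p \<in> curve (triangle_pair s)" for p
  proof -
    have "0 \<le> p $ 2" "p $ 2 \<le> apex s * (1 - \<bar>p $ 1\<bar>)"
      using that by (auto simp: triangle_pair_def curve_tri)
    moreover have "apex s * p $ 1 \<le> apex s * \<bar>p $ 1\<bar>" "apex s * (- p $ 1) \<le> apex s * \<bar>p $ 1\<bar>"
      by (rule mult_left_mono; simp)+
    moreover have "apex s * (1 - \<bar>p $ 1\<bar>) = apex s - apex s * \<bar>p $ 1\<bar>"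
      by (simp add: right_diff_distrib)
    ultimately show ?thesis by linarith
  qed
  have "open_segment x z \<subseteq> interior_region (triangle_pair s)"
  proof
    fix p assume "p \<in> open_segment x z"
    then obtain u where u: "0 < u" "u < 1" "p = (1 - u) *\<^sub>R x + u *\<^sub>R z" by (auto simp: in_segment)
    have pos: "0 < (1 - u) * a + u * b" if "0 \<le> a" "0 \<le> b" "a \<noteq> 0 \<or> b \<noteq> 0" for a b :: real
      using u that by (auto intro: add_pos_nonneg add_nonneg_pos)
    have p: "p $ 1 = (1 - u) * x $ 1 + u * z $ 1" "p $ 2 = (1 - u) * x $ 2 + u * z $ 2"
      using u by simp_all
    have "0 < p $ 2" using pos[of "x $ 2" "z $ 2"] C[OF x] C[OF z] base by (simp add: p)
    moreover have "0 < (1 - u) * (apex s - apex s * x $ 1 - x $ 2) + u * (apex s - apex s * z $ 1 - z $ 2)"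
      using C[OF x] C[OF z] right by (intro pos) auto
    then have "apex s * p $ 1 + p $ 2 < apex s"
      by (simp add: p algebra_simps)
    moreover have "0 < (1 - u) * (apex s + apex s * x $ 1 - x $ 2) + u * (apex s + apex s * z $ 1 - z $ 2)"
      using C[OF x] C[OF z] left by (intro pos) auto
    then have "- apex s * p $ 1 + p $ 2 < apex s"
      by (simp add: p algebra_simps)
    ultimately show "p \<in> interior_region (triangle_pair s)"
      by (auto simp: triangle_pair_def interior_region_tri_eq abs_if algebra_simps)
  qed
  moreover have "\<exists>t. z = x + t \<and> t \<in> tangent_line (triangle_pair (opp s)) y \<and> t \<noteq> 0"
    using t by (intro exI[of _ "z - x"]) auto
  ultimately have tar: "target triangle_pair s x y z"
    using z by (auto simp: target_def)
  then have ex1: "\<exists>!z. target triangle_pair s x y z"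
    using triangle_pair_target_unique[OF y x] by blast
  moreover from tar ex1 have "(THE z. target triangle_pair s x y z) = z"
    by (rule the1_equality[rotated])
  ultimately show ?thesis
    using x y by (simp add: P_max_def condition_A_def phi_def regular_point_def)
qed

section \<open>Regular states and the moves between them\<close>

text \<open>Two points on the two bases are excluded because the tangent at \<open>y\<close> is then
  parallel to the edge of \<open>x\<close> and yields no chord through the interior. The bases are
  the only parallel edges of the two triangles.\<close>

fun regular :: "state \<Rightarrow> bool" where
  "regular (s, x, y) \<longleftrightarrow> regular_point s x \<and> regular_point (opp s) y \<and> (x $ 2 \<noteq> 0 \<or> y $ 2 \<noteq> 0)"

text \<open>The relational form lets membership in the domain and regularity travel along with
  relational powers and closures.\<close>

definition step :: "state \<Rightarrow> state \<Rightarrow> bool" where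
  "step q r \<longleftrightarrow> regular q \<and> q \<in> P_max triangle_pair \<and> phi triangle_pair q = r \<and> regular r"

lemma stepI:
  assumes "regular (s, x, y)" "regular (opp s, y, z)"
    and "z - x \<in> tangent_line (triangle_pair (opp s)) y" "x \<noteq> z"
    and "x $ 2 \<noteq> 0 \<or> z $ 2 \<noteq> 0"
    and "apex s * x $ 1 + x $ 2 \<noteq> apex s \<or> apex s * z $ 1 + z $ 2 \<noteq> apex s"
    and "- apex s * x $ 1 + x $ 2 \<noteq> apex s \<or> - apex s * z $ 1 + z $ 2 \<noteq> apex s"
  shows "step (s, x, y) (opp s, y, z)"
proof -
  have "regular_point s z" using assms(2) by (cases s) auto
  then show ?thesis
    using assms chord[of x s z y] by (auto simp: step_def regular_point_def)
qed

text \<open>The chord has slope \<open>3 * e\<close>. From abscissa \<open>- e / 3\<close> it would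
  pass through the apex of the first triangle, so \<open>a = -1/3\<close> separates the two sides it
  can reach.\<close>

lemma step_base_left:
  assumes "\<bar>e\<bar> = 1" "0 < v" "v < 1" "-1 < a" "a < -1/3"
  shows "step (Minus, base (e * a), side 3 (-e) v) (Plus, side 3 (-e) v, side 1 (-e) (-(1 + 3 * a) / 2))"
  using stepI[of Minus "base (e * a)" "side 3 (-e) v" "side 1 (-e) (-(1 + 3 * a) / 2)"] assms
    regular_point_side[of "-e" "v" Plus] tangent_line_side[of "-e" "v" Plus]
    regular_point_side[of "-e" "-(1 + 3 * a) / 2" Minus]
  by (simp add: in_span_side in_span_base abs_mult vec2_eq_iff) (auto elim!: abs_eq_1E simp: field_simps)

lemma step_base_right:
  assumes "\<bar>e\<bar> = 1" "0 < v" "v < 1" "-1/3 < a" "a < 1"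
  shows "step (Minus, base (e * a), side 3 (-e) v) (Plus, side 3 (-e) v, side 1 e ((1 + 3 * a) / 4))"
  using stepI[of Minus "base (e * a)" "side 3 (-e) v" "side 1 e ((1 + 3 * a) / 4)"] assms
    regular_point_side[of "-e" "v" Plus] tangent_line_side[of "-e" "v" Plus]
    regular_point_side[of "e" "(1 + 3 * a) / 4" Minus]
  by (simp add: in_span_side in_span_base abs_mult vec2_eq_iff) (auto elim!: abs_eq_1E simp: field_simps)

text \<open>The chord has slope \<open>- 3 * e\<close>, steeper than the sides of the first
  triangle, so from either side it descends to the base.\<close>

lemma step_side_opposite:
  assumes "\<bar>e\<bar> = 1" "0 < v" "v < 1" "0 < w" "w < 1"
  shows "step (Minus, side 1 (-e) w, side 3 e v) (Plus, side 3 e v, base (e * (1/3 - 4/3 * w)))"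
  using stepI[of Minus "side 1 (-e) w" "side 3 e v" "base (e * (1/3 - 4/3 * w))"] assms
    regular_point_side[of "-e" "w" Minus]
    regular_point_side[of "e" "v" Plus] tangent_line_side[of "e" "v" Plus]
  by (simp add: in_span_side in_span_base abs_mult vec2_eq_iff) (auto elim!: abs_eq_1E simp: field_simps)

lemma step_side_same:
  assumes "\<bar>e\<bar> = 1" "0 < v" "v < 1" "0 < w" "w < 1"
  shows "step (Minus, side 1 e w, side 3 e v) (Plus, side 3 e v, base (e * ((1 + 2 * w) / 3)))"
  using stepI[of Minus "side 1 e w" "side 3 e v" "base (e * ((1 + 2 * w) / 3))"] assms
    regular_point_side[of "e" "w" Minus]
    regular_point_side[of "e" "v" Plus] tangent_line_side[of "e" "v" Plus]
  by (simp add: in_span_side in_span_base abs_mult vec2_eq_iff) (auto elim!: abs_eq_1E simp: field_simps)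

lemma step_side_base:
  assumes "\<bar>e\<bar> = 1" "0 < w" "w < 1" "\<bar>p\<bar> < 1"
  shows "step (Minus, side 1 e w, base p) (Plus, base p, side 1 (-e) w)"
  using stepI[of Minus "side 1 e w" "base p" "side 1 (-e) w"] assms
    regular_point_side[of "e" "w" Minus]
    tangent_line_base[of "p" Plus]
    regular_point_side[of "-e" "w" Minus]
  by (simp add: in_span_side in_span_base abs_mult vec2_eq_iff) (auto elim!: abs_eq_1E simp: field_simps)

text \<open>The chord rises with slope \<open>1\<close> in absolute value, less than the slope
  \<open>3\<close> of the second triangle, and so it always ends on the opposite side.\<close>

lemma step_shrink:
  assumes "\<bar>e\<bar> = 1" "0 < v" "v < 1" "0 < w" "w < 1"
  shows "step (Plus, side 3 (-e) v, side 1 (-e) w) (Minus, side 1 (-e) w, side 3 e (v / 2))"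
  using stepI[of Plus "side 3 (-e) v" "side 1 (-e) w" "side 3 e (v / 2)"] assms
    regular_point_side[of "-e" "v" Plus]
    regular_point_side[of "-e" "w" Minus] tangent_line_side[of "-e" "w" Minus]
    regular_point_side[of "e" "v / 2" Plus]
  by (simp add: in_span_side in_span_base abs_mult vec2_eq_iff) (auto elim!: abs_eq_1E simp: field_simps)

lemma step_across:
  assumes "\<bar>e\<bar> = 1" "0 < v" "v < 1" "\<bar>a\<bar> < 1"
  shows "step (Plus, side 3 e v, base a) (Minus, base a, side 3 (-e) v)"
  using stepI[of Plus "side 3 e v" "base a" "side 3 (-e) v"] assms
    regular_point_side[of "e" "v" Plus]
    tangent_line_base[of "a" Minus]
    regular_point_side[of "-e" "v" Plus]
  by (simp add: in_span_side in_span_base abs_mult vec2_eq_iff) (auto elim!: abs_eq_1E simp: field_simps)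

text \<open>Here the chord descends with slope \<open>- e\<close>. For \<open>v = 1/2\<close> it
  would meet the corner \<open>pt e 0\<close>; from higher points it reaches the opposite side and
  from lower ones the base.\<close>

lemma step_grow:
  assumes "\<bar>e\<bar> = 1" "0 < v" "v < 1/2" "0 < w" "w < 1"
  shows "step (Plus, side 3 (-e) v, side 1 e w) (Minus, side 1 e w, side 3 e (2 * v))"
  using stepI[of Plus "side 3 (-e) v" "side 1 e w" "side 3 e (2 * v)"] assms
    regular_point_side[of "-e" "v" Plus]
    regular_point_side[of "e" "w" Minus] tangent_line_side[of "e" "w" Minus]
    regular_point_side[of "e" "2 * v" Plus]
  by (simp add: in_span_side in_span_base abs_mult vec2_eq_iff) (auto elim!: abs_eq_1E simp: field_simps)

lemma step_to_base:
  assumes "\<bar>e\<bar> = 1" "1/2 < v" "v < 1" "0 < w" "w < 1"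
  shows "step (Plus, side 3 (-e) v, side 1 e w) (Minus, side 1 e w, base (e * (3 - 4 * v)))"
  using stepI[of Plus "side 3 (-e) v" "side 1 e w" "base (e * (3 - 4 * v))"] assms
    regular_point_side[of "-e" "v" Plus]
    regular_point_side[of "e" "w" Minus] tangent_line_side[of "e" "w" Minus]
  by (simp add: in_span_side in_span_base abs_mult vec2_eq_iff) (auto elim!: abs_eq_1E simp: field_simps)

lemma step_from_base:
  assumes "\<bar>e\<bar> = 1" "0 < w" "w < 1" "\<bar>p\<bar> < 1"
  shows "step (Plus, base (e * p), side 1 (-e) w) (Minus, side 1 (-e) w, side 3 e ((3 + p) / 4))"
  using stepI[of Plus "base (e * p)" "side 1 (-e) w" "side 3 e ((3 + p) / 4)"] assms
    regular_point_side[of "-e" "w" Minus] tangent_line_side[of "-e" "w" Minus]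
    regular_point_side[of "e" "(3 + p) / 4" Plus]
  by (simp add: in_span_side in_span_base abs_mult vec2_eq_iff) (auto elim!: abs_eq_1E simp: field_simps)

section \<open>The return map\<close>

lemma opp_opp [simp]: "opp (opp s) = s"
  by (cases s) auto

text \<open>Measuring \<open>a\<close> relative to the sign \<open>e\<close> absorbs the reflection
  in the axis, so the return map is computed once for both signs.\<close>

definition section_state :: "real \<Rightarrow> real \<Rightarrow> real \<Rightarrow> state" where
  "section_state e a v = (Minus, base (e * a), side 3 (-e) v)"

text \<open>The separate equation \<open>m + n = k\<close> allows the total number of steps to be
  stated in any form.\<close>

lemma relpowp_trans:
  "(R ^^ m) x y \<Longrightarrow> (R ^^ n) y z \<Longrightarrow> m + n = k \<Longrightarrow> (R ^^ k) x z"
  by (auto simp: relpowp_add)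

lemma relpowp_4: "R a b \<Longrightarrow> R b c \<Longrightarrow> R c d \<Longrightarrow> R d e \<Longrightarrow> (R ^^ 4) a e"
  by (auto simp: numeral_eq_Suc)

lemma relpowp_6: "R a b \<Longrightarrow> R b c \<Longrightarrow> R c d \<Longrightarrow> R d e \<Longrightarrow> R e f \<Longrightarrow> R f g \<Longrightarrow> (R ^^ 6) a g"
  by (rule relpowp_trans[OF relpowp_4[of R a b c d e], of 2]) (auto simp: numeral_eq_Suc)

lemma divide_two_power_le: "0 \<le> x \<Longrightarrow> x / 2 ^ n \<le> (x :: real)"
  by (simp add: divide_le_eq mult_le_cancel_left1)

lemma section_left:
  assumes "\<bar>e\<bar> = 1" "0 < v" "v < 1" "-1 < a" "a < -1/3"
  shows "(step ^^ 4) (section_state e a v) (section_state e (1 + 2 * a) (v / 2))"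
proof -
  \<comment> \<open>\<open>w\<close> is the distance from the axis of the point that the first chord
    hits on the first triangle. The orbit returns to the base from there.\<close>
  define w where "w = -(1 + 3 * a) / 2"
  have w: "0 < w" "w < 1" "1/3 - 4/3 * w = 1 + 2 * a" using assms by (auto simp: w_def field_simps)
  have "step (section_state e a v) (Plus, side 3 (-e) v, side 1 (-e) w)"
    unfolding section_state_def w_def using assms by (rule step_base_left)
  moreover have "step (Plus, side 3 (-e) v, side 1 (-e) w) (Minus, side 1 (-e) w, side 3 e (v / 2))"
    using assms w by (intro step_shrink)
  moreover have "step (Minus, side 1 (-e) w, side 3 e (v / 2)) (Plus, side 3 e (v / 2), base (e * (1/3 - 4/3 * w)))"
    using assms w by (intro step_side_opposite) auto
  moreover have "step (Plus, side 3 e (v / 2), base (e * (1/3 - 4/3 * w))) (section_state e (1 + 2 * a) (v / 2))"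
    unfolding section_state_def w(3) using assms by (intro step_across) (auto simp: abs_mult)
  ultimately show ?thesis
    by (rule relpowp_4)
qed

lemma section_grow:
  assumes "\<bar>e\<bar> = 1" "0 < v" "v < 1/2" "-1/3 < a" "a < 1"
  shows "(step ^^ 4) (section_state e a v) (section_state e ((1 + a) / 2) (2 * v))"
proof -
  define w where "w = (1 + 3 * a) / 4"
  have w: "0 < w" "w < 1" "(1 + 2 * w) / 3 = (1 + a) / 2" using assms by (auto simp: w_def field_simps)
  have "step (section_state e a v) (Plus, side 3 (-e) v, side 1 e w)"
    unfolding section_state_def w_def using assms by (intro step_base_right) auto
  moreover have "step (Plus, side 3 (-e) v, side 1 e w) (Minus, side 1 e w, side 3 e (2 * v))"
    using assms w by (intro step_grow)
  moreover have "step (Minus, side 1 e w, side 3 e (2 * v)) (Plus, side 3 e (2 * v), base (e * ((1 + 2 * w) / 3)))"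
    using assms w by (intro step_side_same) auto
  moreover have "step (Plus, side 3 e (2 * v), base (e * ((1 + 2 * w) / 3))) (section_state e ((1 + a) / 2) (2 * v))"
    unfolding section_state_def w(3) using assms by (intro step_across) (auto simp: abs_mult)
  ultimately show ?thesis
    by (rule relpowp_4)
qed

lemma section_turn:
  assumes "\<bar>e\<bar> = 1" "1/2 < v" "v < 1" "-1/3 < a" "a < 1"
  shows "(step ^^ 6) (section_state e a v) (section_state e (- a) (3/2 - v))"
proof -
  define w where "w = (1 + 3 * a) / 4"
  \<comment> \<open>\<open>e * p\<close> is the point where the orbit touches the base of the second
    triangle. This extra reflection accounts for six steps instead of four.\<close>
  define p where "p = 3 - 4 * v"
  have w: "0 < w" "w < 1" "1/3 - 4/3 * w = - a" using assms by (auto simp: w_def field_simps)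
  have p: "\<bar>p\<bar> < 1" "(3 + p) / 4 = 3/2 - v" "\<bar>e * p\<bar> < 1" using assms by (auto simp: p_def abs_mult)
  have "step (section_state e a v) (Plus, side 3 (-e) v, side 1 e w)"
    unfolding section_state_def w_def using assms by (intro step_base_right) auto
  moreover have "step (Plus, side 3 (-e) v, side 1 e w) (Minus, side 1 e w, base (e * p))"
    unfolding p_def using assms w by (intro step_to_base)
  moreover have "step (Minus, side 1 e w, base (e * p)) (Plus, base (e * p), side 1 (-e) w)"
    using assms w p by (intro step_side_base)
  moreover have "step (Plus, base (e * p), side 1 (-e) w) (Minus, side 1 (-e) w, side 3 e (3/2 - v))"
    unfolding p(2)[symmetric] using assms w p by (intro step_from_base)
  moreover have "step (Minus, side 1 (-e) w, side 3 e (3/2 - v)) (Plus, side 3 e (3/2 - v), base (e * (1/3 - 4/3 * w)))"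
    using assms w by (intro step_side_opposite) auto
  moreover have "step (Plus, side 3 e (3/2 - v), base (e * (1/3 - 4/3 * w))) (section_state e (- a) (3/2 - v))"
    unfolding section_state_def w(3) using assms by (intro step_across) (auto simp: abs_mult)
  ultimately show ?thesis
    by (rule relpowp_6)
qed

text \<open>The distance \<open>1 - a\<close> halves in each round, which keeps the abscissa to the
  right of \<open>-1/3\<close>. The bound on the last value \<open>2 ^ n * v\<close> puts all
  earlier ones below \<open>1/2\<close>.\<close>

lemma section_grow_iterated:
  assumes "\<bar>e\<bar> = 1" "-1/3 < a" "a < 1" "0 < v" "2 ^ n * v < 1"
  shows "(step ^^ (4 * n)) (section_state e a v) (section_state e (1 - (1 - a) / 2 ^ n) (2 ^ n * v))"
  using assms(5)
proof (induction n)
  case (Suc n)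
  let ?a = "1 - (1 - a) / 2 ^ n"
  have "2 ^ n * v < 1/2" using Suc.prems by simp
  moreover have "(1 - a) / 2 ^ n \<le> 1 - a"
    using assms by (intro divide_two_power_le) simp
  ultimately have "(step ^^ 4) (section_state e ?a (2 ^ n * v)) (section_state e ((1 + ?a) / 2) (2 * (2 ^ n * v)))"
    using assms by (intro section_grow) auto
  moreover have "(step ^^ (4 * n)) (section_state e a v) (section_state e ?a (2 ^ n * v))"
    using \<open>2 ^ n * v < 1/2\<close> by (intro Suc.IH) auto
  ultimately have "(step ^^ (4 * n + 4)) (section_state e a v) (section_state e ((1 + ?a) / 2) (2 * (2 ^ n * v)))"
    using relpowp_trans by metis
  then show ?case by (simp add: field_simps add.commute)
qed simp

text \<open>The distance \<open>1 + a\<close> from the corner doubles. The bound \<open>4/3\<close>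
  on its last value makes every earlier one less than \<open>2/3\<close>, so that each round starts
  to the left of \<open>-1/3\<close>.\<close>

lemma section_left_iterated:
  assumes "\<bar>e\<bar> = 1" "-1 < a" "0 < v" "v < 1" "2 ^ n * (1 + a) < 4/3"
  shows "(step ^^ (4 * n)) (section_state e a v) (section_state e (2 ^ n * (1 + a) - 1) (v / 2 ^ n))"
  using assms(5)
proof (induction n)
  case (Suc n)
  let ?a = "2 ^ n * (1 + a) - 1"
  have a: "?a < -1/3"
  proof -
    have "2 * (2 ^ n * (1 + a)) < 4/3" using Suc.prems by (simp only: power_Suc mult.assoc)
    then show ?thesis by linarith
  qed
  have "v / 2 ^ n \<le> v" using assms by (intro divide_two_power_le) simp
  with assms have "0 < v / 2 ^ n" "v / 2 ^ n < 1" by (simp, linarith)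
  then have "(step ^^ 4) (section_state e ?a (v / 2 ^ n)) (section_state e (1 + 2 * ?a) (v / 2 ^ n / 2))"
    using assms a by (intro section_left) simp_all
  moreover have "(step ^^ (4 * n)) (section_state e a v) (section_state e ?a (v / 2 ^ n))"
    using a by (intro Suc.IH) auto
  ultimately have "(step ^^ (4 * n + 4)) (section_state e a v) (section_state e (1 + 2 * ?a) (v / 2 ^ n / 2))"
    using relpowp_trans by metis
  then show ?case by (simp add: field_simps add.commute)
qed simp

text \<open>The \<open>n\<close> rounds towards the corner \<open>1\<close> are undone by
  \<open>n\<close> rounds away from the corner \<open>-1\<close>, with the turn between them
  exchanging the corners. The count is \<open>4 * n + 6 + 4 * n\<close>.\<close>

lemma section_half_turn:
  assumes "\<bar>e\<bar> = 1" "\<bar>a\<bar> < 1/3" "1/2 < 2 ^ n * v" "2 ^ n * v < 1"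
  shows "(step ^^ (8 * n + 6)) (section_state e a v) (section_state e (- a) (3/2 / 2 ^ n - v))"
proof -
  have v: "0 < v" using assms(3) by (smt (verit) mult_nonneg_nonpos zero_le_power divide_pos_pos)
  let ?b = "1 - (1 - a) / 2 ^ n"
  let ?w = "3/2 - 2 ^ n * v"
  have pos: "0 < (1 - a) / 2 ^ n" "(1 - a) / 2 ^ n \<le> 1 - a"
    using assms divide_two_power_le[of "1 - a" n] by auto
  have 1: "(step ^^ (4 * n)) (section_state e a v) (section_state e ?b (2 ^ n * v))"
    using assms v by (intro section_grow_iterated) auto
  have 2: "(step ^^ 6) (section_state e ?b (2 ^ n * v)) (section_state e (- ?b) ?w)"
    using assms pos by (intro section_turn) auto
  have 3: "(step ^^ (4 * n)) (section_state e (- ?b) ?w) (section_state e (2 ^ n * (1 + - ?b) - 1) (?w / 2 ^ n))"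
    using assms pos by (intro section_left_iterated) auto
  have "(step ^^ (8 * n + 6)) (section_state e a v) (section_state e (2 ^ n * (1 + - ?b) - 1) (?w / 2 ^ n))"
    by (rule relpowp_trans[OF relpowp_trans[OF 1 2 refl] 3]) simp
  moreover have "2 ^ n * (1 + - ?b) - 1 = - a" "?w / 2 ^ n = 3/2 / 2 ^ n - v"
    by (auto simp: field_simps)
  ultimately show ?thesis by metis
qed

text \<open>The half turn is a point reflection that preserves the rectangle, so applying it twice
  gives the identity.\<close>

lemma section_closed:
  assumes "\<bar>e\<bar> = 1" "\<bar>a\<bar> < 1/3" "1/2 < 2 ^ n * v" "2 ^ n * v < 1"
  shows "(step ^^ (16 * n + 12)) (section_state e a v) (section_state e a v)"
proof -
  have "(step ^^ (8 * n + 6)) (section_state e (- a) (3/2 / 2 ^ n - v)) (section_state e (- (- a)) (3/2 / 2 ^ n - (3/2 / 2 ^ n - v)))"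
    using assms by (intro section_half_turn) (auto simp: field_simps)
  from relpowp_trans[OF section_half_turn[OF assms] this, of "16 * n + 12"] show ?thesis by simp
qed

section \<open>Singular and periodic orbits\<close>

lemma P_max_target:
  assumes "(s, x, y) \<in> P_max triangle_pair"
  obtains z where "phi triangle_pair (s, x, y) = (opp s, y, z)" "target triangle_pair s x y z"
proof -
  have "\<exists>!z. target triangle_pair s x y z" using assms by (simp add: P_max_def condition_A_def)
  from theI'[OF this] show thesis by (intro that) (auto simp: phi_def)
qed

lemma regular_point_if_P_max:
  "(s, x, y) \<in> P_max triangle_pair \<Longrightarrow> x \<in> curve (triangle_pair s) \<and> regular_point (opp s) y"
  by (auto simp: P_max_def condition_A_def regular_point_def)

section \<open>Time reversal and injectivity\<close>

text \<open>The tangent line is a linear subspace and an open segment does not depend on the order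
  of its ends, so a chord can be traversed backwards.\<close>

lemma target_sym:
  assumes "target triangle_pair s x y z" "x \<in> curve (triangle_pair s)" "regular_point (opp s) y"
  shows "target triangle_pair s z y x"
proof -
  obtain d where "tangent_line (triangle_pair (opp s)) y = span {d}"
    using assms(3) by (cases rule: regular_point_cases) (auto simp: tangent_line_base tangent_line_side)
  then have neg: "- t \<in> tangent_line (triangle_pair (opp s)) y" if "t \<in> tangent_line (triangle_pair (opp s)) y" for t
    using that by (simp add: span_neg)
  obtain t where "z = x + t" "t \<in> tangent_line (triangle_pair (opp s)) y" "t \<noteq> 0"
    using assms(1) by (auto simp: target_def)
  then have "\<exists>t. x = z + t \<and> t \<in> tangent_line (triangle_pair (opp s)) y \<and> t \<noteq> 0"
    using neg by (intro exI[of _ "- t"]) auto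
  then show ?thesis
    using assms by (auto simp: target_def open_segment_commute)
qed

text \<open>Time reversal: after the swap, the unique chord leads from \<open>z\<close> back to
  \<open>x\<close>.\<close>

lemma phi_swap_state:
  assumes "q \<in> P_max triangle_pair"
  shows "phi triangle_pair (swap_state (phi triangle_pair q)) = swap_state q"
proof -
  obtain s x y where q: "q = (s, x, y)" by (cases q)
  obtain z where z: "phi triangle_pair (s, x, y) = (opp s, y, z)" "target triangle_pair s x y z"
    using assms P_max_target q by metis
  have x: "x \<in> curve (triangle_pair s)" and y: "regular_point (opp s) y"
    using regular_point_if_P_max assms q by auto
  have zx: "target triangle_pair s z y x" using target_sym z x y by blast
  moreover have "z \<in> curve (triangle_pair s)" using z by (simp add: target_def)
  ultimately have "(THE w. target triangle_pair s z y w) = x"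
    using triangle_pair_target_unique[OF y] by blast
  moreover have "swap_state (phi triangle_pair q) = (s, z, y)" by (simp add: q z(1) swap_state_def)
  ultimately show ?thesis by (simp add: q swap_state_def phi_def)
qed

lemma swap_swap [simp]: "swap_state (swap_state q) = q"
  by (cases q) (simp add: swap_state_def)

lemma step_left_unique: "step q r \<Longrightarrow> step q' r \<Longrightarrow> q = q'"
  unfolding step_def by (metis phi_swap_state swap_swap)

lemma relpowp_left_unique:
  assumes "(step ^^ n) q r" "(step ^^ n) q' r"
  shows "q = q'"
  using assms
proof (induction n arbitrary: r)
  case (Suc n)
  then show ?case by (metis relpowp_Suc_E step_left_unique)
qed simp

lemma relpowp_phi: "(step ^^ n) q r \<Longrightarrow> (phi triangle_pair ^^ n) q = r"
proof (induction n arbitrary: r)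
  case (Suc n)
  then show ?case by (auto simp: step_def)
qed simp

text \<open>An injective map has no strictly preperiodic points: walking round the cycle once more
  and then cancelling the last \<open>m\<close> steps shows that \<open>q\<close> itself returns
  after \<open>n\<close> steps.\<close>

lemma periodic_if_reaches_cycle:
  assumes "step\<^sup>*\<^sup>* q r" "(step ^^ n) r r" "1 \<le> n"
  shows "periodic triangle_pair q"
proof -
  obtain m where m: "(step ^^ m) q r" using assms(1) by (auto simp: rtranclp_power)
  have "(step ^^ (n + m)) q r"
    using relpowp_trans[OF m assms(2)] by (simp add: add.commute)
  then obtain q' where "(step ^^ n) q q'" "(step ^^ m) q' r"
    by (auto simp: relpowp_add)
  moreover from this have "q' = q" using relpowp_left_unique m by blast
  ultimately show ?thesis
    using assms(3) relpowp_phi unfolding periodic_def by blast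
qed

section \<open>Orbits that run into a vertex\<close>

text \<open>This is the forward half of \<open>N_set\<close>, before the swapped copy is
  added.\<close>

definition singular :: "state set" where
  "singular = (\<Union>i. N_step triangle_pair i)"

lemma singular_base: "x \<in> curve (triangle_pair s) \<Longrightarrow> y \<in> set (triangle_pair (opp s)) \<Longrightarrow> (s, x, y) \<in> singular"
  unfolding singular_def by (intro UN_I[of 0]) auto

lemma singular_step: "q \<in> P_max triangle_pair \<Longrightarrow> phi triangle_pair q \<in> singular \<Longrightarrow> q \<in> singular"
  unfolding singular_def using N_step.simps(2) by blast

lemma step_singular: "step q r \<Longrightarrow> q \<notin> singular \<Longrightarrow> r \<notin> singular"
  unfolding step_def using singular_step by blast

lemma steps_singular: "(step ^^ n) q r \<Longrightarrow> q \<notin> singular \<Longrightarrow> r \<notin> singular"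
proof (induction n arbitrary: r)
  case (Suc n)
  then show ?case by (metis relpowp_Suc_E step_singular)
qed simp

text \<open>The chord ends at the vertex \<open>z\<close>, so the next state belongs to
  \<open>N_step\<close> at \<open>0\<close>.\<close>

lemma singular_vertex:
  assumes "regular_point s x" "regular_point (opp s) y" "z \<in> set (triangle_pair s)"
    and "z - x \<in> tangent_line (triangle_pair (opp s)) y"
    and "x $ 2 \<noteq> 0 \<or> z $ 2 \<noteq> 0"
    and "apex s * x $ 1 + x $ 2 \<noteq> apex s \<or> apex s * z $ 1 + z $ 2 \<noteq> apex s"
    and "- apex s * x $ 1 + x $ 2 \<noteq> apex s \<or> - apex s * z $ 1 + z $ 2 \<noteq> apex s"
  shows "(s, x, y) \<in> singular"
proof -
  have z: "z \<in> curve (triangle_pair s)" using assms(3) by (auto simp: triangle_pair_def set_tri curve_tri)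
  have "x \<noteq> z" using assms(1,3) by (auto simp: regular_point_def)
  then have "(s, x, y) \<in> P_max triangle_pair \<and> phi triangle_pair (s, x, y) = (opp s, y, z)"
    using assms z by (intro chord) (auto simp: regular_point_def)
  moreover have "(opp s, y, z) \<in> singular"
    using assms by (intro singular_base) (auto simp: regular_point_def)
  ultimately show ?thesis using singular_step by metis
qed

text \<open>The chord from this boundary value of \<open>a\<close> runs into the apex of the first
  triangle.\<close>

lemma singular_base_middle:
  assumes "\<bar>e\<bar> = 1" "0 < v" "v < 1"
  shows "section_state e (-1/3) v \<in> singular"
  unfolding section_state_def
  using singular_vertex[of Minus "base (e * (-1/3))" "side 3 (-e) v" "pt 0 1"] assms
    regular_point_side[of "-e" v Plus] tangent_line_side[of "-e" v Plus]
  by (simp add: in_span_side abs_mult triangle_pair_def set_tri) (auto elim!: abs_eq_1E)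

text \<open>The chord from the midpoint of a side of the second triangle runs into the corner
  \<open>pt e 0\<close>.\<close>

lemma singular_side_middle:
  assumes "\<bar>e\<bar> = 1" "0 < w" "w < 1"
  shows "(Plus, side 3 (-e) (1/2), side 1 e w) \<in> singular"
  using singular_vertex[of Plus "side 3 (-e) (1/2)" "side 1 e w" "pt e 0"] assms
    regular_point_side[of "-e" "1/2" Plus]
    regular_point_side[of "e" "w" Minus] tangent_line_side[of "e" "w" Minus]
  by (simp add: in_span_side triangle_pair_def set_tri) (auto elim!: abs_eq_1E)

lemma singular_section_half:
  assumes "\<bar>e\<bar> = 1" "-1/3 < a" "a < 1"
  shows "section_state e a (1/2) \<in> singular"
proof (rule ccontr)
  assume "section_state e a (1/2) \<notin> singular"
  moreover have "step (section_state e a (1/2)) (Plus, side 3 (-e) (1/2), side 1 e ((1 + 3 * a) / 4))"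
    unfolding section_state_def using assms by (intro step_base_right) auto
  ultimately show False
    using singular_side_middle[of e "(1 + 3 * a) / 4"] step_singular assms by auto
qed

text \<open>Doubling \<open>t\<close> eventually reaches \<open>c\<close>; the last power before
  that brings it into the upper half of the interval.\<close>

lemma dyadic_scale:
  fixes t c :: real
  assumes "0 < t" "t < c"
  obtains n where "c / 2 \<le> 2 ^ n * t" "2 ^ n * t < c"
proof -
  obtain m where m: "c / t < 2 ^ m" using real_arch_pow[of 2 "c / t"] by auto
  have ex: "c \<le> 2 ^ m * t" using m assms by (simp add: field_simps)
  define k where "k = (LEAST k. c \<le> 2 ^ k * t)"
  have k: "c \<le> 2 ^ k * t" unfolding k_def by (rule LeastI[of "\<lambda>k. c \<le> 2 ^ k * t", OF ex])
  then have "k \<noteq> 0" using assms by (intro notI) simp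
  then obtain n where n: "k = Suc n" by (cases k) auto
  have "\<not> c \<le> 2 ^ n * t" using not_less_Least[of n "\<lambda>k. c \<le> 2 ^ k * t"] n k_def by auto
  then show thesis using k n by (intro that[of n]) auto
qed

text \<open>After the doublings the second coordinate lies in \<open>[1/2, 1)\<close>, and the value
  \<open>1/2\<close> would make the orbit singular.\<close>

lemma section_band:
  assumes "\<bar>e\<bar> = 1" "-1/3 < a" "a < 1" "0 < v" "v < 1" "section_state e a v \<notin> singular"
  obtains n where "1/2 < 2 ^ n * v" "2 ^ n * v < 1"
proof -
  obtain n where n: "1 / 2 \<le> 2 ^ n * v" "2 ^ n * v < 1" using dyadic_scale[of v 1] assms by auto
  have "section_state e (1 - (1 - a) / 2 ^ n) (2 ^ n * v) \<notin> singular"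
    using section_grow_iterated[of e a v n] steps_singular assms n by blast
  moreover have "-1/3 < 1 - (1 - a) / 2 ^ n" using assms divide_two_power_le[of "1 - a" n] by linarith
  moreover have "1 - (1 - a) / 2 ^ n < 1" using assms by simp
  ultimately have "2 ^ n * v \<noteq> 1 / 2"
    using singular_section_half[of e "1 - (1 - a) / 2 ^ n"] assms(1) by metis
  then show thesis using n that by force
qed

text \<open>Rounds of the first kind bring the distance from the corner \<open>-1\<close> into
  \<open>[2/3, 4/3)\<close>, that is \<open>a\<close> into \<open>[-1/3, 1/3)\<close>. The left end
  is singular, and the remaining points lie in the rectangles of periodic points.\<close>

lemma section_reaches_cycle_left:
  assumes "\<bar>e\<bar> = 1" "-1 < a" "a < 1/3" "0 < v" "v < 1" "section_state e a v \<notin> singular"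
  shows "\<exists>r n. step\<^sup>*\<^sup>* (section_state e a v) r \<and> (step ^^ n) r r \<and> 1 \<le> n"
proof -
  obtain n where n: "2/3 \<le> 2 ^ n * (1 + a)" "2 ^ n * (1 + a) < 4/3"
    using dyadic_scale[of "1 + a" "4/3"] assms by auto
  define b w where "b = 2 ^ n * (1 + a) - 1" and "w = v / 2 ^ n"
  have w: "0 < w" "w < 1" unfolding w_def using assms divide_two_power_le[of v n] by (simp, linarith)
  have reach: "(step ^^ (4 * n)) (section_state e a v) (section_state e b w)"
    unfolding b_def w_def using assms n by (intro section_left_iterated)
  then have ns: "section_state e b w \<notin> singular" using steps_singular assms by blast
  then have "b \<noteq> -1/3" using singular_base_middle[of e w] assms w by auto
  then have b: "-1/3 < b" "b < 1/3" using n by (auto simp: b_def)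
  obtain k where "1/2 < 2 ^ k * w" "2 ^ k * w < 1"
    using section_band[OF assms(1), of b w] b w ns by auto
  then have "(step ^^ (16 * k + 12)) (section_state e b w) (section_state e b w)"
    using assms b by (intro section_closed) auto
  moreover have "step\<^sup>*\<^sup>* (section_state e a v) (section_state e b w)"
    using reach by (rule relpowp_imp_rtranclp)
  ultimately show ?thesis by (metis trans_le_add2 one_le_numeral)
qed

text \<open>If \<open>a\<close> is at least \<open>1/3\<close>, growing can only increase it, and
  the following turn changes its sign; this leads to the previous case.\<close>

lemma section_reaches_cycle:
  assumes "\<bar>e\<bar> = 1" "\<bar>a\<bar> < 1" "0 < v" "v < 1" "section_state e a v \<notin> singular"
  shows "\<exists>r n. step\<^sup>*\<^sup>* (section_state e a v) r \<and> (step ^^ n) r r \<and> 1 \<le> n"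
proof (cases "a < 1/3")
  case True
  then show ?thesis using assms by (intro section_reaches_cycle_left) auto
next
  case False
  obtain n where n: "1/2 < 2 ^ n * v" "2 ^ n * v < 1"
    using section_band[of e a v] assms False by auto
  define b where "b = 1 - (1 - a) / 2 ^ n"
  have b: "1/3 \<le> b" unfolding b_def using assms False divide_two_power_le[of "1 - a" n] by linarith
  have b1: "b < 1" unfolding b_def using assms by simp
  note b = b b1
  have "(step ^^ (4 * n)) (section_state e a v) (section_state e b (2 ^ n * v))"
    unfolding b_def using assms False n by (intro section_grow_iterated) auto
  moreover have "(step ^^ 6) (section_state e b (2 ^ n * v)) (section_state e (- b) (3/2 - 2 ^ n * v))"
    using assms b n by (intro section_turn) auto
  ultimately have reach: "(step ^^ (4 * n + 6)) (section_state e a v) (section_state e (- b) (3/2 - 2 ^ n * v))"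
    using relpowp_trans by metis
  then have "section_state e (- b) (3/2 - 2 ^ n * v) \<notin> singular" using steps_singular assms by blast
  then obtain r m where "step\<^sup>*\<^sup>* (section_state e (- b) (3/2 - 2 ^ n * v)) r" "(step ^^ m) r r" "1 \<le> m"
    using section_reaches_cycle_left[of e "- b" "3/2 - 2 ^ n * v"] assms b n by auto
  moreover have "step\<^sup>*\<^sup>* (section_state e a v) (section_state e (- b) (3/2 - 2 ^ n * v))"
    using reach by (rule relpowp_imp_rtranclp)
  ultimately show ?thesis by (meson rtranclp_trans)
qed

section \<open>From every regular state to the section\<close>

definition reaches_section :: "state \<Rightarrow> bool" where
  "reaches_section q \<longleftrightarrow> (\<exists>e a v. \<bar>e\<bar> = 1 \<and> \<bar>a\<bar> < 1 \<and> 0 < v \<and> v < 1 \<and> step\<^sup>*\<^sup>* q (section_state e a v))"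

lemma reaches_section_step: "step q r \<Longrightarrow> reaches_section r \<Longrightarrow> reaches_section q"
  unfolding reaches_section_def by (meson converse_rtranclp_into_rtranclp)

lemma reaches_section_refl:
  assumes "\<bar>f\<bar> = 1" "\<bar>a\<bar> < 1" "0 < v" "v < 1"
  shows "reaches_section (Minus, base a, side 3 f v)"
proof -
  have "(Minus, base a, side 3 f v) = section_state (-f) (- (f * a)) v"
    using assms(1) by (rule abs_eq_1E) (simp_all add: section_state_def)
  moreover have "\<bar>- f\<bar> = 1" "\<bar>- (f * a)\<bar> < 1" using assms by (simp_all add: abs_mult)
  ultimately show ?thesis
    using assms unfolding reaches_section_def by (metis rtranclp.rtrancl_refl)
qed

lemma reaches_section_across:
  assumes "\<bar>f\<bar> = 1" "\<bar>a\<bar> < 1" "0 < v" "v < 1"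
  shows "reaches_section (Plus, side 3 f v, base a)"
  using reaches_section_step[OF step_across[of f v a] reaches_section_refl[of "- f" a v]] assms by simp

lemma reaches_section_sides:
  assumes "\<bar>f\<bar> = 1" "\<bar>g\<bar> = 1" "0 < v" "v < 1" "0 < w" "w < 1"
  shows "reaches_section (Minus, side 1 f w, side 3 g v)"
proof -
  have "f = g \<or> f = - g" using assms(1,2) by (auto elim!: abs_eq_1E)
  then show ?thesis
  proof
    assume f: "f = - g"
    have "\<bar>g * (1/3 - 4/3 * w)\<bar> < 1" using assms by (auto simp: abs_mult)
    then show ?thesis
      unfolding f using reaches_section_step[OF step_side_opposite[of g v w] reaches_section_across] assms by simp
  next
    assume f: "f = g"
    have "\<bar>g * ((1 + 2 * w) / 3)\<bar> < 1" using assms by (auto simp: abs_mult)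
    then show ?thesis
      unfolding f using reaches_section_step[OF step_side_same[of g v w] reaches_section_across] assms by simp
  qed
qed

lemma reaches_section_from_base:
  assumes "\<bar>f\<bar> = 1" "\<bar>p\<bar> < 1" "0 < w" "w < 1"
  shows "reaches_section (Plus, base p, side 1 f w)"
proof -
  \<comment> \<open>\<open>p'\<close> is the abscissa relative to the sign \<open>- f\<close>, in
    the form that \<open>step_from_base\<close> takes.\<close>
  define p' where "p' = - (f * p)"
  have p: "p = - (f * p')" using assms(1) by (rule abs_eq_1E) (simp_all add: p'_def)
  have "\<bar>p'\<bar> < 1" using assms by (simp add: p'_def abs_mult)
  then have "0 < (3 + p') / 4" "(3 + p') / 4 < 1" by auto
  then show ?thesis
    unfolding p using reaches_section_step[OF step_from_base[of "- f" w p'] reaches_section_sides] assms \<open>\<bar>p'\<bar> < 1\<close>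
    by simp
qed

lemma reaches_section_side_base:
  assumes "\<bar>f\<bar> = 1" "\<bar>p\<bar> < 1" "0 < w" "w < 1"
  shows "reaches_section (Minus, side 1 f w, base p)"
  using reaches_section_step[OF step_side_base[of f w p] reaches_section_from_base] assms by simp

text \<open>This is the one configuration on the way to the section in which a chord can run into a
  vertex, namely for opposite signs and \<open>v = 1/2\<close>.\<close>

lemma reaches_section_Plus_sides:
  assumes "\<bar>f\<bar> = 1" "\<bar>g\<bar> = 1" "0 < v" "v < 1" "0 < w" "w < 1"
    and "(Plus, side 3 f v, side 1 g w) \<notin> singular"
  shows "reaches_section (Plus, side 3 f v, side 1 g w)"
proof -
  have "f = g \<or> f = - g" using assms(1,2) by (auto elim!: abs_eq_1E)
  then show ?thesis
  proof
    assume f: "f = g"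
    show ?thesis
      unfolding f using reaches_section_step[OF step_shrink[of "- g" v w, unfolded minus_minus] reaches_section_sides[of g "- g" "v / 2" w]] assms
      by simp
  next
    assume f: "f = - g"
    have "v \<noteq> 1/2"
    proof
      assume v: "v = 1/2"
      show False using assms(7) singular_side_middle[OF assms(2,5,6)] unfolding f v by contradiction
    qed
    then consider "v < 1/2" | "1/2 < v" by linarith
    then show ?thesis
    proof cases
      case 1
      then show ?thesis
        unfolding f using reaches_section_step[OF step_grow[of g v w] reaches_section_sides] assms by simp
    next
      case 2
      then have "\<bar>g * (3 - 4 * v)\<bar> < 1" using assms by (auto simp: abs_mult)
      with 2 show ?thesis
        unfolding f using reaches_section_step[OF step_to_base[of g v w] reaches_section_side_base] assms by simp
    qed
  qed
qed

text \<open>With two bases excluded, three combinations of edges remain for each sign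
  \<open>s\<close>, each treated by one of the preceding lemmas.\<close>

lemma reaches_section_regular:
  assumes "regular q" "q \<notin> singular"
  shows "reaches_section q"
proof -
  obtain s x y where q: "q = (s, x, y)" by (cases q)
  have x: "regular_point s x" and y: "regular_point (opp s) y" and xy: "x $ 2 \<noteq> 0 \<or> y $ 2 \<noteq> 0"
    using assms(1) by (auto simp: q)
  show ?thesis
  proof (cases s)
    case Minus
    show ?thesis
      using x
    proof (cases rule: regular_point_cases)
      case (1 a)
      from y show ?thesis
      proof (cases rule: regular_point_cases)
        case (1 b)
        then show ?thesis using xy \<open>x = base a\<close> by simp
      next
        case (2 f u)
        then show ?thesis using 1 Minus q reaches_section_refl[of f a u] by simp
      qed
    next
      case (2 f w)
      from y show ?thesis
      proof (cases rule: regular_point_cases)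
        case (1 b)
        then show ?thesis using 2 Minus q reaches_section_side_base[of f b w] by simp
      next
        case (2 g v)
        then show ?thesis using \<open>x = side _ f w\<close> \<open>\<bar>f\<bar> = 1\<close> \<open>0 < w\<close> \<open>w < 1\<close> Minus q reaches_section_sides[of f g v w] by simp
      qed
    qed
  next
    case Plus
    show ?thesis
      using x
    proof (cases rule: regular_point_cases)
      case (1 a)
      from y show ?thesis
      proof (cases rule: regular_point_cases)
        case (1 b)
        then show ?thesis using xy \<open>x = base a\<close> by simp
      next
        case (2 f u)
        then show ?thesis using 1 Plus q reaches_section_from_base[of f a u] by simp
      qed
    next
      case (2 f w)
      from y show ?thesis
      proof (cases rule: regular_point_cases)
        case (1 b)
        then show ?thesis using 2 Plus q reaches_section_across[of f b w] by simp
      next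
        case (2 g v)
        then show ?thesis
          using \<open>x = side _ f w\<close> \<open>\<bar>f\<bar> = 1\<close> \<open>0 < w\<close> \<open>w < 1\<close> Plus q assms(2) reaches_section_Plus_sides[of f g w v] by simp
      qed
    qed
  qed
qed

lemma phase_space_regular:
  assumes "q \<in> phase_space triangle_pair"
  shows "regular q" "q \<notin> singular"
proof -
  show "q \<notin> singular" using assms by (auto simp: phase_space_def N_set_def singular_def)
  obtain s x y where q: "q = (s, x, y)" by (cases q)
  have P: "(s, x, y) \<in> P_max triangle_pair" using assms q by (simp add: phase_space_def)
  have x: "x \<in> curve (triangle_pair s)" and y: "regular_point (opp s) y"
    using regular_point_if_P_max P by auto
  have "x \<notin> set (triangle_pair s)"
  proof
    assume "x \<in> set (triangle_pair s)"
    \<comment> \<open>The vertex is in the first component, so the swapped half of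
      \<open>N_set\<close> is what excludes it.\<close>
    then have "(opp s, y, x) \<in> singular"
      using y by (intro singular_base) (auto simp: regular_point_def)
    then have "swap_state (opp s, y, x) \<in> N_set triangle_pair"
      unfolding N_set_def singular_def by blast
    then show False using assms q by (simp add: swap_state_def phase_space_def)
  qed
  moreover have "x $ 2 \<noteq> 0 \<or> y $ 2 \<noteq> 0"
  proof (rule ccontr)
    assume "\<not> (x $ 2 \<noteq> 0 \<or> y $ 2 \<noteq> 0)"
    then have 0: "x $ 2 = 0" "y $ 2 = 0" by auto
    from y obtain a where a: "\<bar>a\<bar> < 1" "y = base a"
      using 0 by (cases rule: regular_point_cases) auto
    obtain z where z: "target triangle_pair s x y z" using P_max_target[OF P] by blast
    then have "z $ 2 = 0" "x \<noteq> z"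
      using 0 a by (auto simp: target_def tangent_line_base in_span_base)
    \<comment> \<open>A chord along the base would have its midpoint at height \<open>0\<close>, but
      interior points have positive height.\<close>
    have "midpoint x z $ 2 = 0" using 0 \<open>z $ 2 = 0\<close> by (simp add: midpoint_def)
    moreover have "midpoint x z \<in> open_segment x z" using \<open>x \<noteq> z\<close> by simp
    moreover have "0 < p $ 2" if "p \<in> open_segment x z" for p
      using z that by (auto simp: target_def triangle_pair_def interior_region_tri_eq)
    ultimately show False by fastforce
  qed
  ultimately show "regular q" using x y q by (simp add: regular_point_def)
qed

lemma phase_space_periodic:
  assumes "q \<in> phase_space triangle_pair"
  shows "periodic triangle_pair q"
proof -
  note q = phase_space_regular[OF assms]
  obtain e a v where sec: "\<bar>e\<bar> = 1" "\<bar>a\<bar> < 1" "0 < v" "v < 1" "step\<^sup>*\<^sup>* q (section_state e a v)"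
    using reaches_section_regular[OF q] unfolding reaches_section_def by blast
  moreover from this have "section_state e a v \<notin> singular"
    using q(2) steps_singular by (metis rtranclp_imp_relpowp)
  ultimately obtain r n where "step\<^sup>*\<^sup>* (section_state e a v) r" "(step ^^ n) r r" "1 \<le> n"
    using section_reaches_cycle by blast
  then show ?thesis using sec(5) periodic_if_reaches_cycle by (meson rtranclp_trans)
qed

section \<open>Cycles lie in the phase space\<close>

lemma cycle_successor:
  assumes "step\<^sup>+\<^sup>+ q q" obtains r where "step q r" "step\<^sup>+\<^sup>+ r r"
  using tranclpD[OF assms] rtranclp_into_tranclp1 by metis

lemma cycle_predecessor:
  assumes "step\<^sup>+\<^sup>+ q q" obtains r where "step r q" "step\<^sup>+\<^sup>+ r r"
  using assms
proof cases
  case r_into_trancl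
  then show thesis using assms that by blast
next
  case (trancl_into_trancl y)
  then show thesis using that[of y] tranclp_trans[of step y q y] by blast
qed

text \<open>All states on a cycle are regular, so following it forwards never meets a vertex. Time
  reversal turns the swapped orbit into the same cycle run backwards.\<close>

lemma cycle_not_singular:
  assumes "step\<^sup>+\<^sup>+ q q"
  shows "q \<notin> N_step triangle_pair i" "swap_state q \<notin> N_step triangle_pair i"
proof -
  show "q \<notin> N_step triangle_pair i"
    using assms
  proof (induction i arbitrary: q)
    case 0
    then obtain r where "step q r" by (rule cycle_successor)
    then show ?case by (cases q) (auto simp: step_def regular_point_def)
  next
    case (Suc i)
    obtain r where "step q r" "step\<^sup>+\<^sup>+ r r" using cycle_successor[OF Suc.prems] by blast
    moreover from this have "phi triangle_pair q = r" by (simp add: step_def)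
    ultimately show ?case using Suc.IH by auto
  qed
  show "swap_state q \<notin> N_step triangle_pair i"
    using assms
  proof (induction i arbitrary: q)
    case 0
    then obtain r where "step q r" by (rule cycle_successor)
    then show ?case by (cases q) (auto simp: step_def regular_point_def swap_state_def)
  next
    case (Suc i)
    obtain r where r: "step r q" "step\<^sup>+\<^sup>+ r r" using cycle_predecessor[OF Suc.prems] by blast
    then have "phi triangle_pair (swap_state q) = swap_state r"
      using phi_swap_state[of r] by (simp add: step_def)
    then show ?case using Suc.IH[OF r(2)] by simp
  qed
qed

lemma cycle_in_phase_space:
  assumes "step\<^sup>+\<^sup>+ q q"
  shows "q \<in> phase_space triangle_pair"
proof -
  have "q \<in> P_max triangle_pair" using cycle_successor[OF assms] unfolding step_def by metis
  moreover have "q \<notin> N_set triangle_pair"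
    using cycle_not_singular[OF assms] by (force simp: N_set_def)
  ultimately show ?thesis by (simp add: phase_space_def)
qed

section \<open>Unbounded periods\<close>

lemma long_period:
  "\<exists>q \<in> phase_space triangle_pair. B < period triangle_pair q"
proof -
  \<comment> \<open>With \<open>a = 0\<close> this is the centre of the rectangle for
    \<open>n = B\<close>, since \<open>3/4\<close> is the midpoint of \<open>1/2\<close> and
    \<open>1\<close>.\<close>
  define v :: real where "v = 3/4 / 2 ^ B"
  define q where "q = section_state 1 0 v"
  have v: "0 < v" "2 ^ B * v = 3/4" by (auto simp: v_def)
  have closed: "(step ^^ (16 * B + 12)) q q"
    unfolding q_def using v by (intro section_closed) auto
  then have "step\<^sup>+\<^sup>+ q q" unfolding tranclp_power by (intro exI[of _ "16 * B + 12"]) simp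
  then have q: "q \<in> phase_space triangle_pair" by (rule cycle_in_phase_space)
  moreover have "B < period triangle_pair q"
  proof (rule ccontr)
    define n where "n = period triangle_pair q"
    assume "\<not> B < period triangle_pair q"
    then have "n \<le> B" by (simp add: n_def)
    \<comment> \<open>A return time exists, so the \<open>LEAST\<close> in \<open>period\<close> is
      attained.\<close>
    have "1 \<le> 16 * B + 12 \<and> (phi triangle_pair ^^ (16 * B + 12)) q = q"
      using relpowp_phi[OF closed] by simp
    then have n: "1 \<le> n" "(phi triangle_pair ^^ n) q = q"
      unfolding n_def period_def by (metis (mono_tags, lifting) LeastI)+
    have "(phi triangle_pair ^^ (n * k)) q = q" for k
      using n(2) by (induction k) (auto simp: funpow_add)
    \<comment> \<open>A growing round takes four steps, so \<open>4 * n\<close> steps double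
      \<open>v\<close> exactly \<open>n\<close> times. This fits below \<open>1\<close> because
      \<open>n \<le> B\<close>, and it contradicts a return to \<open>q\<close>.\<close>
    then have "(phi triangle_pair ^^ (4 * n)) q = q" by (metis mult.commute)
    moreover have "2 ^ n * v \<le> 2 ^ B * v"
      using v \<open>n \<le> B\<close> by (intro mult_right_mono power_increasing) auto
    then have "(step ^^ (4 * n)) q (section_state 1 (1 - (1 - 0) / 2 ^ n) (2 ^ n * v))"
      unfolding q_def using v by (intro section_grow_iterated) auto
    ultimately have "section_state 1 (1 - (1 - 0) / 2 ^ n) (2 ^ n * v) = section_state 1 0 v"
      using relpowp_phi q_def by metis
    then have "2 ^ n * v = v" by (auto simp: section_state_def vec2_eq_iff)
    moreover have "(2 :: real) ^ n > 1" using n by simp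
    ultimately show False using v by simp
  qed
  ultimately show ?thesis by blast
qed

theorem theorem1p2:
  "\<exists>Q :: polygon_pair.
     (\<forall>s. polygon (Q s)) \<and>
     (\<forall>p\<in>phase_space Q. periodic Q p) \<and>
     \<not> (\<exists>B. \<forall>p\<in>phase_space Q. period Q p \<le> B)"
proof (intro exI[of _ triangle_pair] conjI allI ballI notI)
  show "polygon (triangle_pair s)" for s by (simp add: triangle_pair_def polygon_tri)
  show "periodic triangle_pair p" if "p \<in> phase_space triangle_pair" for p using that by (rule phase_space_periodic)
  assume "\<exists>B. \<forall>p\<in>phase_space triangle_pair. period triangle_pair p \<le> B"
  then show False using long_period by (meson not_less)
qed

end
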